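(* Let $D$ be an irreducible electron-photon Feynman diagram satisfying the Main condition: at each vertex of $D$ exactly two electron lines and one photon line meet, and of these three lines two are internal and one is external. Let $N_e, N_p$ be the numbers of external electron and external photon lines of $D$, $F_e, F_p$ the numbers of internal electron and internal photon lines of $D$, $n$ the number of vertices of $D$, and $\mathcal{Q}$ the number of contact points of $D$. Then the internal data $\mathcal{Q}, n, F_e, F_p$ are recovered from the external data $N_e, N_p$ by $$\mathcal{Q}=N_e,\qquad n=N_e+N_p,\qquad F_p=\frac{N_e}{2},\qquad F_e=N_p+\frac{N_e}{2}.$$
   Context: A Feynman diagram (electron-photon interaction) consists of finitely many vertices, directed external lines and undirected internal lines; every line is either an electron line or a photon line. An internal line connects two vertices (it has two ends, each at a vertex); an external line is attached to exactly one vertex, at which it begins or ends (outgoing or incoming). The diagram is irreducible if it cannot be split into two disconnected parts by removing an internal line. Under the Main condition, a vertex is called a contact point if an internal electron line and an internal photon line meet at it; equivalently, if an external (incoming or outgoing) electron line is attached to it. *)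

theory Defs
  imports Complex_Main "HOL-Library.Multiset"
begin

datatype line_kind = Electron | Photon

text \<open>An \<open>Outgoing\<close> line begins at its vertex, an \<open>Incoming\<close> line ends there.\<close>

datatype direction = Incoming | Outgoing

text \<open>
  A diagram is a multigraph: several internal lines may join the same vertices. The multiset
  \<open>int_ends D l\<close> lists the vertices at which the two ends of the undirected line \<open>l\<close> lie, so
  a line with both ends at one vertex \<open>v\<close> has \<open>int_ends D l = {#v, v#}\<close>.
\<close>

record ('v, 'i, 'e) diagram =
  verts :: "'v set"
  int_lines :: "'i set"
  int_kind :: "'i \<Rightarrow> line_kind"
  int_ends :: "'i \<Rightarrow> 'v multiset"
  ext_lines :: "'e set"
  ext_kind :: "'e \<Rightarrow> line_kind"
  ext_dir :: "'e \<Rightarrow> direction"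
  ext_vertex :: "'e \<Rightarrow> 'v"

definition feynman_diagram :: "('v, 'i, 'e) diagram \<Rightarrow> bool" where
  "feynman_diagram D \<longleftrightarrow>
     finite (verts D) \<and> finite (int_lines D) \<and> finite (ext_lines D) \<and>
     (\<forall>l \<in> int_lines D. size (int_ends D l) = 2 \<and> set_mset (int_ends D l) \<subseteq> verts D) \<and>
     (\<forall>l \<in> ext_lines D. ext_vertex D l \<in> verts D)"

definition int_lines_of :: "('v, 'i, 'e) diagram \<Rightarrow> line_kind \<Rightarrow> 'i set" where
  "int_lines_of D k = {l \<in> int_lines D. int_kind D l = k}"

definition ext_lines_of :: "('v, 'i, 'e) diagram \<Rightarrow> line_kind \<Rightarrow> 'e set" where
  "ext_lines_of D k = {l \<in> ext_lines D. ext_kind D l = k}"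

definition remove_int_line :: "('v, 'i, 'e) diagram \<Rightarrow> 'i \<Rightarrow> ('v, 'i, 'e) diagram" where
  "remove_int_line D l = D\<lparr>int_lines := int_lines D - {l}\<rparr>"

text \<open>External lines play no role here: each stays with the vertex it is attached to.\<close>

definition splits_into_two :: "('v, 'i, 'e) diagram \<Rightarrow> bool" where
  "splits_into_two D \<longleftrightarrow>
     (\<exists>A B. A \<noteq> {} \<and> B \<noteq> {} \<and> A \<inter> B = {} \<and> A \<union> B = verts D \<and>
        (\<forall>l \<in> int_lines D. set_mset (int_ends D l) \<subseteq> A \<or> set_mset (int_ends D l) \<subseteq> B))"

definition irreducible_diagram :: "('v, 'i, 'e) diagram \<Rightarrow> bool" where
  "irreducible_diagram D \<longleftrightarrow>
     (\<forall>l \<in> int_lines D. \<not> splits_into_two (remove_int_line D l))"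

text \<open>
  The lines meeting at a vertex are counted by their ends there, so a line with both ends at
  the vertex counts twice.
\<close>

definition int_count_at :: "('v, 'i, 'e) diagram \<Rightarrow> line_kind \<Rightarrow> 'v \<Rightarrow> nat" where
  "int_count_at D k v = (\<Sum>l \<in> int_lines_of D k. count (int_ends D l) v)"

definition ext_count_at :: "('v, 'i, 'e) diagram \<Rightarrow> line_kind \<Rightarrow> 'v \<Rightarrow> nat" where
  "ext_count_at D k v = card {l \<in> ext_lines_of D k. ext_vertex D l = v}"

definition main_condition :: "('v, 'i, 'e) diagram \<Rightarrow> bool" where
  "main_condition D \<longleftrightarrow>
     (\<forall>v \<in> verts D.
        int_count_at D Electron v + ext_count_at D Electron v = 2 \<and>
        int_count_at D Photon v + ext_count_at D Photon v = 1 \<and>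
        int_count_at D Electron v + int_count_at D Photon v = 2 \<and>
        ext_count_at D Electron v + ext_count_at D Photon v = 1)"

definition contact_point :: "('v, 'i, 'e) diagram \<Rightarrow> 'v \<Rightarrow> bool" where
  "contact_point D v \<longleftrightarrow>
     v \<in> verts D \<and>
     (\<exists>l \<in> int_lines_of D Electron. v \<in># int_ends D l) \<and>
     (\<exists>l \<in> int_lines_of D Photon. v \<in># int_ends D l)"

end

theory Submission
  imports Defs
begin

text \<open>
  The Main condition leaves two kinds of vertices: those with an external electron line, which are
  exactly the contact points (one internal electron end, one internal photon end), and those with an
  external photon line (two internal electron ends, no internal photon end). Counting line ends
  vertex by vertex, where an internal line has two ends and an external line one, gives all four
  identities.
\<close>

text \<open>Double counting: after swapping the sums, each line contributes its two ends, both of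
  which lie in \<open>verts D\<close>; a loop contributes 2 at its single vertex.\<close>

lemma sum_int_count_at:
  assumes "feynman_diagram D"
  shows "(\<Sum>v\<in>verts D. int_count_at D k v) = 2 * card (int_lines_of D k)"
proof -
  have ends: "(\<Sum>v\<in>verts D. count (int_ends D l) v) = 2" if "l \<in> int_lines_of D k" for l
  proof -
    have "(\<Sum>v\<in>verts D. count (int_ends D l) v) = size (int_ends D l)"
      \<comment> \<open>The size sums the counts over \<open>set_mset\<close> only; the other
        vertices add zeros.\<close>
      unfolding size_multiset_overloaded_eq
      using assms that
      by (intro sum.mono_neutral_right) (auto simp: feynman_diagram_def int_lines_of_def not_in_iff)
    then show ?thesis
      using assms that by (simp add: feynman_diagram_def int_lines_of_def)
  qed
  have "(\<Sum>v\<in>verts D. int_count_at D k v)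
      = (\<Sum>l\<in>int_lines_of D k. \<Sum>v\<in>verts D. count (int_ends D l) v)"
    unfolding int_count_at_def by (rule sum.swap)
  then show ?thesis
    by (simp add: ends)
qed

text \<open>The fibres of \<open>ext_vertex D\<close> over \<open>verts D\<close> partition the
  external lines of each kind.\<close>

lemma sum_ext_count_at:
  assumes "feynman_diagram D"
  shows "(\<Sum>v\<in>verts D. ext_count_at D k v) = card (ext_lines_of D k)"
proof -
  have "(\<Sum>v\<in>verts D. \<Sum>l | l \<in> ext_lines_of D k \<and> ext_vertex D l = v. 1::nat)
      = (\<Sum>l\<in>ext_lines_of D k. 1)"
    using assms by (intro sum.group) (auto simp: feynman_diagram_def ext_lines_of_def)
  then show ?thesis
    by (simp add: ext_count_at_def)
qed

lemma int_count_at_pos_iff: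
  assumes "feynman_diagram D"
  shows "int_count_at D k v > 0 \<longleftrightarrow> (\<exists>l\<in>int_lines_of D k. v \<in># int_ends D l)"
proof -
  have "finite (int_lines_of D k)"
    using assms by (simp add: feynman_diagram_def int_lines_of_def)
  then show ?thesis
    \<comment> \<open>In the form \<open>\<noteq> 0\<close> the claim follows because a finite sum
      of naturals vanishes iff every term does.\<close>
    unfolding int_count_at_def neq0_conv[symmetric] by (simp add: not_in_iff)
qed

text \<open>Comparing the two sums equal to 2 shows that the external electron count equals the
  internal photon count. It is at most 1, so an internal electron end is always present and only the
  photon end decides contact.\<close>

lemma ext_electron_count_eq_contact:
  assumes "feynman_diagram D" "main_condition D" "v \<in> verts D"
  shows "ext_count_at D Electron v = (if contact_point D v then 1 else 0)"
proof -
  have "int_count_at D Electron v + ext_count_at D Electron v = 2"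
    "int_count_at D Electron v + int_count_at D Photon v = 2"
    "ext_count_at D Electron v + ext_count_at D Photon v = 1"
    using assms(2,3) by (auto simp: main_condition_def)
  moreover have "contact_point D v \<longleftrightarrow> int_count_at D Electron v > 0 \<and> int_count_at D Photon v > 0"
    using assms(1,3) by (simp add: contact_point_def int_count_at_pos_iff)
  ultimately show ?thesis
    by auto
qed

theorem mainTheorem1:
  fixes D :: "('v, 'i, 'e) diagram"
    and N_e N_p F_e F_p n Q :: nat
  assumes "feynman_diagram D"
    and "irreducible_diagram D"
    and "main_condition D"
    and "N_e = card (ext_lines_of D Electron)"
    and "N_p = card (ext_lines_of D Photon)"
    and "F_e = card (int_lines_of D Electron)"
    and "F_p = card (int_lines_of D Photon)"
    and "n = card (verts D)"
    and "Q = card {v. contact_point D v}"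
  shows "Q = N_e \<and> n = N_e + N_p \<and>
         real F_p = real N_e / 2 \<and> real F_e = real N_p + real N_e / 2"
proof -
  note fd = assms(1) and mc = assms(3)
  have fin: "finite (verts D)"
    using fd by (simp add: feynman_diagram_def)
  have "{v. contact_point D v} = verts D \<inter> {v. contact_point D v}"
    by (auto simp: contact_point_def)
  then have "Q = (\<Sum>v\<in>verts D. if contact_point D v then 1 else 0)"
    using fin by (simp add: assms(9) sum.If_cases)
  also have "\<dots> = (\<Sum>v\<in>verts D. ext_count_at D Electron v)"
    by (intro sum.cong) (simp_all add: ext_electron_count_eq_contact[OF fd mc])
  finally have Q: "Q = N_e"
    by (simp add: sum_ext_count_at[OF fd] assms(4))
  have "(\<Sum>v\<in>verts D. ext_count_at D Electron v + ext_count_at D Photon v) = card (verts D)"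
    using mc by (simp add: main_condition_def)
  then have n: "n = N_e + N_p"
    by (simp add: sum.distrib sum_ext_count_at[OF fd] assms(4,5,8))
  have "(\<Sum>v\<in>verts D. int_count_at D Electron v + ext_count_at D Electron v) = 2 * card (verts D)"
    using mc by (simp add: main_condition_def)
  then have electrons: "2 * F_e + N_e = 2 * n"
    by (simp add: sum.distrib sum_int_count_at[OF fd] sum_ext_count_at[OF fd] assms(4,6,8))
  have "(\<Sum>v\<in>verts D. int_count_at D Photon v + ext_count_at D Photon v) = card (verts D)"
    using mc by (simp add: main_condition_def)
  then have photons: "2 * F_p + N_p = n"
    by (simp add: sum.distrib sum_int_count_at[OF fd] sum_ext_count_at[OF fd] assms(5,7,8))
  \<comment> \<open>Substituting \<open>n = N_e + N_p\<close> leaves \<open>2 * F_p = N_e\<close>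
    and \<open>2 * F_e = 2 * N_p + N_e\<close>, to be halved in the reals.\<close>
  show ?thesis
    using Q n electrons photons by auto
qed

end
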